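(* Let $\mathcal{F} \subset \mathcal{S}$. (1) If the function $G \colon I \to \mathbb{R}$, $G(x) := \sup_{f \in \mathcal{F}} \frac{f''(x)}{f'(x)}$, is continuous, then $\mathscr{U}_{\mathcal{F}} = A^{[g]}$, where $g \in \mathcal{S}$ and $g''/g' = G$. (2) If the function $H \colon I \to \mathbb{R}$, $H(x) := \inf_{f \in \mathcal{F}} \frac{f''(x)}{f'(x)}$, is continuous, then $\mathscr{L}_{\mathcal{F}} = A^{[h]}$, where $h \in \mathcal{S}$ and $h''/h' = H$.
   Context: $I \subset \mathbb{R}$ is an interval. $\mathcal{CM}$ denotes the family of all continuous, strictly monotone functions $f \colon I \to \mathbb{R}$. $\mathcal{S}$ denotes the family of all $\mathcal{C}^2$ functions $f \colon I \to \mathbb{R}$ whose first derivative vanishes nowhere on $I$ (so $\mathcal{S} \subset \mathcal{CM}$). For $f \in \mathcal{CM}$ the quasi-arithmetic mean $A^{[f]} \colon \bigcup_{n=1}^\infty I^n \to I$ is defined by $A^{[f]}(v) := f^{-1}\left(\frac{f(v_1)+\cdots+f(v_n)}{n}\right)$ for $n \in \mathbb{N}$, $v \in I^n$. For $f, g \in \mathcal{CM}$ write $f \prec g$ if $A^{[f]}(v) \le A^{[g]}(v)$ for all $v \in \bigcup_{n \in \mathbb{N}} I^n$. Functions in $\mathcal{S}$ with the same ratio $u''/u'$ differ by an affine transformation and generate the same quasi-arithmetic mean. For $f \in \mathcal{CM}$ put $U_f := \{ s \in \mathcal{CM} : f \prec s\}$ and $L_f := \{ s \in \mathcal{CM} :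 s \prec f\}$. For $\mathcal{F} \subset \mathcal{CM}$ define $\mathscr{U}_{\mathcal{F}}, \mathscr{L}_{\mathcal{F}} \colon \bigcup_{n=1}^\infty I^n \to I$ by: $\mathscr{U}_{\mathcal{F}}(v) := \inf\{A^{[s]}(v) : s \in \bigcap_{f \in \mathcal{F}} U_f\}$ if $\bigcap_{f \in \mathcal{F}} U_f \neq \emptyset$, and $\mathscr{U}_{\mathcal{F}}(v) := \max(v)$ otherwise; $\mathscr{L}_{\mathcal{F}}(v) := \sup\{A^{[s]}(v) : s \in \bigcap_{f \in \mathcal{F}} L_f\}$ if $\bigcap_{f \in \mathcal{F}} L_f \neq \emptyset$, and $\mathscr{L}_{\mathcal{F}}(v) := \min(v)$ otherwise. *)

theory Defs
  imports "HOL-Analysis.Analysis"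
begin

text \<open>
  A function on the interval \<open>I\<close> is represented by a total function of type
  \<open>real \<Rightarrow> real\<close>; all notions below depend only on its values on \<open>I\<close>.
  Elements of \<open>I\<^sup>1 \<union> I\<^sup>2 \<union> \<dots>\<close> are nonempty lists with entries in \<open>I\<close>.
\<close>

definition tuples :: "real set \<Rightarrow> real list set" where
  "tuples I = {v. v \<noteq> [] \<and> set v \<subseteq> I}"

definition CM :: "real set \<Rightarrow> (real \<Rightarrow> real) set" where
  "CM I = {f. continuous_on I f \<and> (strict_mono_on I f \<or> strict_antimono_on I f)}"

text \<open>
  Derivatives are taken within \<open>I\<close>, hence one-sided at an endpoint belonging to \<open>I\<close>.
\<close>

definition deriv_on :: "real set \<Rightarrow> (real \<Rightarrow> real) \<Rightarrow> real \<Rightarrow> real" where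
  "deriv_on I f x = vector_derivative f (at x within I)"

definition C2_on :: "real set \<Rightarrow> (real \<Rightarrow> real) \<Rightarrow> bool" where
  "C2_on I f \<longleftrightarrow> f differentiable_on I \<and> deriv_on I f differentiable_on I \<and>
     continuous_on I (deriv_on I (deriv_on I f))"

definition S_class :: "real set \<Rightarrow> (real \<Rightarrow> real) set" where
  "S_class I = {f. C2_on I f \<and> (\<forall>x\<in>I. deriv_on I f x \<noteq> 0)}"

definition deriv_ratio :: "real set \<Rightarrow> (real \<Rightarrow> real) \<Rightarrow> real \<Rightarrow> real" where
  "deriv_ratio I f x = deriv_on I (deriv_on I f) x / deriv_on I f x"

definition qa_mean :: "real set \<Rightarrow> (real \<Rightarrow> real) \<Rightarrow> real list \<Rightarrow> real" where
  "qa_mean I f v = inv_into I f (sum_list (map f v) / real (length v))"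

definition qa_le :: "real set \<Rightarrow> (real \<Rightarrow> real) \<Rightarrow> (real \<Rightarrow> real) \<Rightarrow> bool" where
  "qa_le I f g \<longleftrightarrow> (\<forall>v\<in>tuples I. qa_mean I f v \<le> qa_mean I g v)"

definition upper_set :: "real set \<Rightarrow> (real \<Rightarrow> real) \<Rightarrow> (real \<Rightarrow> real) set" where
  "upper_set I f = {s \<in> CM I. qa_le I f s}"

definition lower_set :: "real set \<Rightarrow> (real \<Rightarrow> real) \<Rightarrow> (real \<Rightarrow> real) set" where
  "lower_set I f = {s \<in> CM I. qa_le I s f}"

text \<open>
  Intersections of families of subsets of \<open>CM I\<close> are formed inside \<open>CM I\<close>; this
  matters only for the empty family. The infimum and supremum of reals below are taken over
  bounded sets, as every mean of \<open>v\<close> lies between \<open>Min (set v)\<close> and \<open>Max (set v)\<close>.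
\<close>

definition upper_mean :: "real set \<Rightarrow> (real \<Rightarrow> real) set \<Rightarrow> real list \<Rightarrow> real" where
  "upper_mean I F v =
     (if CM I \<inter> (\<Inter>f\<in>F. upper_set I f) \<noteq> {}
      then INF s\<in>CM I \<inter> (\<Inter>f\<in>F. upper_set I f). qa_mean I s v
      else Max (set v))"

definition lower_mean :: "real set \<Rightarrow> (real \<Rightarrow> real) set \<Rightarrow> real list \<Rightarrow> real" where
  "lower_mean I F v =
     (if CM I \<inter> (\<Inter>f\<in>F. lower_set I f) \<noteq> {}
      then SUP s\<in>CM I \<inter> (\<Inter>f\<in>F. lower_set I f). qa_mean I s v
      else Min (set v))"

end

theory Submission
  imports Defs
begin

text \<open>
  A function \<open>s\<close> is called convex with respect to a generator \<open>f\<close> if \<open>s (A\<^sup>f v)\<close> is at most the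
  arithmetic mean of the values \<open>s v\<^sub>i\<close>, that is, if \<open>s \<circ> f\<inverse>\<close> satisfies Jensen's inequality with
  equal weights. For increasing \<open>s\<close> this says \<open>f \<prec> s\<close>, for decreasing \<open>s\<close> it says
  \<open>s \<prec> f\<close>. Since \<open>s\<close> and \<open>- s\<close> generate the same mean, every comparison of means can be
  read as such a convexity property, and both halves of the theorem become instances of one
  statement, \<open>qa_convex_transfer\<close>: if \<open>s\<close> is convex with respect to generators \<open>f \<in> S\<close> whose
  ratios \<open>f''/f'\<close> at each given point come arbitrarily close to bounding that of \<open>g \<in> S\<close> from
  above (from below, if \<open>s\<close> is decreasing), then \<open>s\<close> is convex with respect to \<open>g\<close>.

  The difficulty is that \<open>s\<close> is merely continuous and monotone, so that no differential
  characterisation of \<open>f \<prec> s\<close> is available. It is replaced by an argument with test functions.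
  If \<open>s \<circ> g\<inverse>\<close> is not convex, then some strictly concave parabola touches it from above at an
  interior point (\<open>convex_on_if_not_touched_by_concave_parabola\<close>). In the variable of \<open>I\<close>, the
  function \<open>s\<close> is touched from above at some \<open>x\<^sub>0\<close> by a smooth function
  \<open>q = s x\<^sub>0 + p (g - g x\<^sub>0) - e (g - g x\<^sub>0)\<^sup>2\<close>. Convexity of \<open>s\<close> with respect to \<open>f\<close> is inherited by
  \<open>q\<close> at \<open>x\<^sub>0\<close> and gives \<open>q'' - q' f''/f' \<ge> 0\<close> there, which reads
  \<open>2 e g'\<^sup>2 \<le> p g' (g''/g' - f''/f')\<close> (\<open>second_order_condition_at_touching_point\<close>). As the
  parabola is fixed before \<open>f\<close> is chosen, an \<open>f\<close> whose ratio nearly bounds that of \<open>g\<close> at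
  \<open>x\<^sub>0\<close> contradicts this.

  Applied to a single generator, the same statement shows that \<open>f''/f' \<le> g''/g'\<close> implies
  \<open>f \<prec> g\<close>. Hence a solution \<open>g\<close> of \<open>g''/g' = G\<close> belongs to \<open>\<Inter>f. U\<^sub>f\<close>, and its mean is the least
  one there; such a \<open>g\<close> is obtained by integrating the continuous function \<open>G\<close>, exponentiating,
  and integrating again.
\<close>

section \<open>Second-order tests\<close>

lemma strict_local_max_second_derivative:
  fixes r r1 :: "real \<Rightarrow> real"
  assumes r: "\<And>x. a < x \<Longrightarrow> x < b \<Longrightarrow> (r has_real_derivative r1 x) (at x)"
    and r1: "(r1 has_real_derivative m) (at x0)"
    and x0: "a < x0" "x0 < b" and crit: "r1 x0 = 0" "m < 0"
  obtains c d where "a < c" "c < x0" "x0 < d" "d < b"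
    "\<And>x. c \<le> x \<Longrightarrow> x \<le> d \<Longrightarrow> x \<noteq> x0 \<Longrightarrow> r x < r x0"
proof -
  obtain e1 where e1: "e1 > 0" "\<And>h. 0 < h \<Longrightarrow> h < e1 \<Longrightarrow> r1 (x0 + h) < 0"
    using DERIV_neg_dec_right[OF r1 crit(2)] crit(1) by auto
  obtain e2 where e2: "e2 > 0" "\<And>h. 0 < h \<Longrightarrow> h < e2 \<Longrightarrow> 0 < r1 (x0 - h)"
    using DERIV_neg_dec_left[OF r1 crit(2)] crit(1) by auto
  obtain d where d: "x0 < d" "d < min b (x0 + e1)"
    using dense[of x0 "min b (x0 + e1)"] x0 e1(1) by auto
  obtain c where c: "max a (x0 - e2) < c" "c < x0"
    using dense[of "max a (x0 - e2)" x0] x0 e2(1) by auto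
  have "r x < r x0" if x: "c \<le> x" "x \<le> d" "x \<noteq> x0" for x
  proof (cases "x0 < x")
    case True
    have "\<And>y. x0 \<le> y \<Longrightarrow> y \<le> x \<Longrightarrow> (r has_real_derivative r1 y) (at y)"
      using x d x0 by (intro r) auto
    then obtain z where z: "x0 < z" "z < x" "r x - r x0 = (x - x0) * r1 z"
      using MVT2[OF True, of r r1] by blast
    have "r1 z < 0" using e1(2)[of "z - x0"] z x d by auto
    then show ?thesis using z True by (smt (verit) mult_pos_neg)
  next
    case False
    then have less: "x < x0" using x by auto
    have "\<And>y. x \<le> y \<Longrightarrow> y \<le> x0 \<Longrightarrow> (r has_real_derivative r1 y) (at y)"
      using x c x0 by (intro r) auto
    then obtain z where z: "x < z" "z < x0" "r x0 - r x = (x0 - x) * r1 z"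
      using MVT2[OF less, of r r1] by blast
    have "0 < r1 z" using e2(2)[of "x0 - z"] z x c by auto
    then show ?thesis using z less by (smt (verit) mult_pos_pos)
  qed
  then show ?thesis using that[of c d] c d by auto
qed

text \<open>
  This is the one-dimensional viscosity criterion for convexity. If \<open>\<phi>\<close> exceeds a chord
  somewhere, it still exceeds the chord after a small multiple of \<open>(t - a) (b - t)\<close> has been
  subtracted; at a maximum of the difference, a parabola with negative leading coefficient touches
  \<open>\<phi>\<close> from above.
\<close>

lemma convex_on_if_not_touched_by_concave_parabola:
  fixes \<phi> :: "real \<Rightarrow> real"
  assumes "convex J" and cont: "continuous_on J \<phi>"
    and no_touch: "\<And>a b t p e. a \<in> J \<Longrightarrow> b \<in> J \<Longrightarrow> a < t \<Longrightarrow> t < b \<Longrightarrow> e > 0 \<Longrightarrow>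
      \<exists>u\<in>{a..b}. \<phi> u > \<phi> t + p * (u - t) - e * (u - t)\<^sup>2"
  shows "convex_on J \<phi>"
proof (rule convex_on_linorderI)
  show "convex J" by fact
next
  fix w a b :: real
  assume l: "0 < w" "w < 1" and ab: "a \<in> J" "b \<in> J" "a < b"
  define z where "z = (1 - w) * a + w * b"
  have za: "z - a = w * (b - a)" and bz: "b - z = (1 - w) * (b - a)"
    by (simp_all add: z_def algebra_simps)
  have "0 < z - a" "0 < b - z" unfolding za bz using l ab by simp_all
  then have z: "a < z" "z < b" by simp_all
  define k where "k = (\<phi> b - \<phi> a) / (b - a)"
  have k: "k * (b - a) = \<phi> b - \<phi> a" using ab by (simp add: k_def)
  show "\<phi> ((1 - w) *\<^sub>R a + w *\<^sub>R b) \<le> (1 - w) * \<phi> a + w * \<phi> b"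
  proof (rule ccontr)
    assume "\<not> ?thesis"
    then have gap: "\<phi> z > (1 - w) * \<phi> a + w * \<phi> b" by (simp add: z_def)
    have chord: "\<phi> a + k * (z - a) = (1 - w) * \<phi> a + w * \<phi> b"
    proof -
      have "k * (z - a) = w * (\<phi> b - \<phi> a)" by (simp add: za flip: k)
      then show ?thesis by (simp add: algebra_simps)
    qed
    define D where "D = \<phi> z - (\<phi> a + k * (z - a))"
    have D: "D > 0" using gap chord by (simp add: D_def)
    \<comment> \<open>The penalty removes exactly half of the gap at \<open>z\<close>.\<close>
    define e where "e = D / (2 * ((z - a) * (b - z)))"
    have e: "e > 0" using D z by (simp add: e_def)
    define \<eta> where "\<eta> = (\<lambda>t. \<phi> t - (\<phi> a + k * (t - a)) - e * ((t - a) * (b - t)))"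
    have sub: "{a..b} \<subseteq> J" using ab \<open>convex J\<close>
      by (metis closed_segment_subset closed_segment_eq_real_ivl1 less_imp_le)
    have "continuous_on {a..b} \<eta>" unfolding \<eta>_def
      by (intro continuous_intros continuous_on_subset[OF cont sub])
    then obtain t where t: "t \<in> {a..b}" "\<And>u. u \<in> {a..b} \<Longrightarrow> \<eta> u \<le> \<eta> t"
      using continuous_attains_sup[of "{a..b}" \<eta>] ab by auto
    have "\<eta> z = D / 2" using z D by (simp add: \<eta>_def e_def D_def divide_simps)
    then have "\<eta> t > 0" using t(2)[of z] z D by auto
    moreover have "\<eta> a = 0" "\<eta> b = 0" using k by (simp_all add: \<eta>_def)
    ultimately have "t \<noteq> a" "t \<noteq> b" by auto
    then have t': "a < t" "t < b" using t(1) by auto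
    \<comment> \<open>\<open>p\<close> is the slope at \<open>t\<close> of the chord plus the penalty.\<close>
    define p where "p = k + e * (b - t) - e * (t - a)"
    obtain u where u: "u \<in> {a..b}" "\<phi> u > \<phi> t + p * (u - t) - e * (u - t)\<^sup>2"
      using no_touch[OF ab(1,2) t' e, of p] by blast
    have "\<eta> u - \<eta> t = \<phi> u - (\<phi> t + p * (u - t) - e * (u - t)\<^sup>2)"
      by (simp add: \<eta>_def p_def power2_eq_square algebra_simps)
    then show False using t(2)[OF u(1)] u(2) by auto
  qed
qed

section \<open>Quasi-arithmetic means and relative convexity\<close>

lemma inv_into_neg: "inv_into I (\<lambda>x. - f x) (- y) = inv_into I f (y::real)"
  by (simp add: inv_into_def)

lemma qa_mean_neg: "qa_mean I (\<lambda>x. - f x) v = qa_mean I f v"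
proof -
  have "sum_list (map (\<lambda>x. - f x) v) = - sum_list (map f v)"
    by (induction v) auto
  then show ?thesis
    using inv_into_neg[of I f "sum_list (map f v) / real (length v)"]
    by (simp add: qa_mean_def)
qed

lemma average_as_sum:
  assumes "v \<noteq> []"
  shows "sum_list (map f v) / real (length v) = (\<Sum>i<length v. 1 / real (length v) * f (v ! i))"
    "(\<Sum>i<length v. 1 / real (length v)) = 1"
  using assms by (auto simp: sum_list_sum_nth atLeast0LessThan sum_divide_distrib)

lemma average_in_image:
  assumes "is_interval I" "continuous_on I f" "v \<in> tuples I"
  shows "sum_list (map f v) / real (length v) \<in> f ` I"
proof -
  have v: "v \<noteq> []" "set v \<subseteq> I" using assms(3) by (auto simp: tuples_def)
  have "convex (f ` I)"
    using connected_continuous_image[OF assms(2)] assms(1)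
    by (simp add: is_interval_connected_1 flip: is_interval_convex_1)
  then have "(\<Sum>i<length v. (1 / real (length v)) *\<^sub>R f (v ! i)) \<in> f ` I"
    using v average_as_sum(2)[OF v(1)] by (intro convex_sum) (auto intro: nth_mem)
  then show ?thesis unfolding average_as_sum(1)[OF v(1)] by simp
qed

lemma qa_mean_in_interval:
  assumes "is_interval I" "continuous_on I f" "v \<in> tuples I"
  shows "qa_mean I f v \<in> I" and "f (qa_mean I f v) = sum_list (map f v) / real (length v)"
  using average_in_image[OF assms] by (auto simp: qa_mean_def inv_into_into f_inv_into_f)

definition qa_convex :: "real set \<Rightarrow> (real \<Rightarrow> real) \<Rightarrow> (real \<Rightarrow> real) \<Rightarrow> bool" where
  "qa_convex I f s \<longleftrightarrow>
     (\<forall>v\<in>tuples I. s (qa_mean I f v) \<le> sum_list (map s v) / real (length v))"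

text \<open>
  Apply \<open>s\<close> to the inequality between the means. In the version for decreasing \<open>s\<close> the order is
  reversed, so that the same convexity property expresses the opposite comparison.
\<close>

lemma qa_le_iff_qa_convex:
  assumes "is_interval I" "continuous_on I f" "continuous_on I s" "strict_mono_on I s"
  shows "qa_le I f s \<longleftrightarrow> qa_convex I f s"
proof -
  have "qa_mean I f v \<le> qa_mean I s v \<longleftrightarrow>
      s (qa_mean I f v) \<le> sum_list (map s v) / real (length v)" if "v \<in> tuples I" for v
    using strict_mono_on_less_eq[OF assms(4), of "qa_mean I f v" "qa_mean I s v"]
      qa_mean_in_interval[OF assms(1,2) that] qa_mean_in_interval[OF assms(1,3) that] by simp
  then show ?thesis by (auto simp: qa_le_def qa_convex_def)
qed

lemma qa_ge_iff_qa_convex: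
  assumes "is_interval I" "continuous_on I f" "continuous_on I s" "strict_antimono_on I s"
  shows "qa_le I s f \<longleftrightarrow> qa_convex I f s"
proof -
  have mono: "strict_mono_on I (\<lambda>x. - s x)"
    using assms(4) by (auto simp: monotone_on_def)
  have "qa_mean I s v \<le> qa_mean I f v \<longleftrightarrow>
      s (qa_mean I f v) \<le> sum_list (map s v) / real (length v)" if "v \<in> tuples I" for v
    using strict_mono_on_less_eq[OF mono, of "qa_mean I s v" "qa_mean I f v"]
      qa_mean_in_interval[OF assms(1,2) that] qa_mean_in_interval[OF assms(1,3) that] by simp
  then show ?thesis by (auto simp: qa_le_def qa_convex_def)
qed

section \<open>Twice differentiable generators\<close>

lemma at_within_interval_neq_bot:
  fixes I :: "real set"
  assumes "is_interval I" "interior I \<noteq> {}" "x \<in> I"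
  shows "at x within I \<noteq> bot"
proof -
  have "I \<noteq> {y}" for y using assms(2) by auto
  then have "x islimpt I"
    using assms(1,3) by (intro connected_imp_perfect) (auto simp: is_interval_connected_1)
  then show ?thesis by (simp add: trivial_limit_within)
qed

lemma deriv_on_eq:
  assumes "is_interval I" "interior I \<noteq> {}" "x \<in> I" "(f has_real_derivative D) (at x within I)"
  shows "deriv_on I f x = D"
  using vector_derivative_within[OF at_within_interval_neq_bot[OF assms(1-3)]] assms(4)
  by (simp add: deriv_on_def has_real_derivative_iff_has_vector_derivative)

lemma differentiable_on_deriv_on:
  assumes "f differentiable_on I" "x \<in> I"
  shows "(f has_real_derivative deriv_on I f x) (at x within I)"
  using assms vector_derivative_works[of f "at x within I"]
  by (simp add: differentiable_on_def deriv_on_def has_real_derivative_iff_has_vector_derivative)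

lemma S_class_derivs:
  assumes "f \<in> S_class I" "x \<in> I"
  shows "(f has_real_derivative deriv_on I f x) (at x within I)"
    "(deriv_on I f has_real_derivative deriv_on I (deriv_on I f) x) (at x within I)"
    "deriv_on I f x \<noteq> 0"
  using assms differentiable_on_deriv_on[of f I x] differentiable_on_deriv_on[of "deriv_on I f" I x]
  by (simp_all add: S_class_def C2_on_def)

lemma S_class_continuous:
  assumes "f \<in> S_class I"
  shows "continuous_on I f" "continuous_on I (deriv_on I f)"
  by (rule DERIV_continuous_on, erule S_class_derivs[OF assms])+

text \<open>
  Derivatives within \<open>I\<close> are unique because a nondegenerate interval has no isolated points, so any
  functions that behave like the first and second derivatives determine the ratio.
\<close>

lemma S_classI:
  assumes I: "is_interval I" "interior I \<noteq> {}"
    and f: "\<And>x. x \<in> I \<Longrightarrow> (f has_real_derivative f1 x) (at x within I)"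
    and f1: "\<And>x. x \<in> I \<Longrightarrow> (f1 has_real_derivative f2 x) (at x within I)"
    and f2: "continuous_on I f2" and nz: "\<And>x. x \<in> I \<Longrightarrow> f1 x \<noteq> 0"
  shows "f \<in> S_class I" "\<And>x. x \<in> I \<Longrightarrow> deriv_on I f x = f1 x"
    "\<And>x. x \<in> I \<Longrightarrow> deriv_ratio I f x = f2 x / f1 x"
proof -
  show D1: "deriv_on I f x = f1 x" if "x \<in> I" for x
    using deriv_on_eq[OF I that f[OF that]] .
  have "(deriv_on I f has_real_derivative f2 x) (at x within I)" if "x \<in> I" for x
    using has_vector_derivative_transform[OF that D1] f1[OF that]
    by (simp add: has_real_derivative_iff_has_vector_derivative)
  note deriv1 = this
  have D2: "deriv_on I (deriv_on I f) x = f2 x" if "x \<in> I" for x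
    using deriv_on_eq[OF I that deriv1[OF that]] .
  show "deriv_ratio I f x = f2 x / f1 x" if "x \<in> I" for x
    using that by (simp add: deriv_ratio_def D1 D2)
  have "continuous_on I (deriv_on I (deriv_on I f))"
    using f2 by (simp add: D2 cong: continuous_on_cong)
  moreover have "f differentiable_on I" "deriv_on I f differentiable_on I"
    using f deriv1 unfolding differentiable_on_def real_differentiable_def by blast+
  ultimately show "f \<in> S_class I" using nz D1 by (simp add: S_class_def C2_on_def)
qed

lemma S_class_neg:
  assumes I: "is_interval I" "interior I \<noteq> {}" and f: "f \<in> S_class I"
  shows "(\<lambda>x. - f x) \<in> S_class I" "\<And>x. x \<in> I \<Longrightarrow> deriv_on I (\<lambda>x. - f x) x = - deriv_on I f x"
    "\<And>x. x \<in> I \<Longrightarrow> deriv_ratio I (\<lambda>x. - f x) x = deriv_ratio I f x"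
proof -
  have "continuous_on I (\<lambda>x. - deriv_on I (deriv_on I f) x)"
    using f by (intro continuous_on_minus) (simp add: S_class_def C2_on_def)
  note neg = S_classI[OF I DERIV_minus DERIV_minus this,
      OF S_class_derivs(1)[OF f] S_class_derivs(2)[OF f]]
  show "(\<lambda>x. - f x) \<in> S_class I"
    using S_class_derivs(3)[OF f] by (intro neg(1)) simp_all
  show "deriv_on I (\<lambda>x. - f x) x = - deriv_on I f x" if "x \<in> I" for x
    using S_class_derivs(3)[OF f] that by (intro neg(2)) simp_all
  have "deriv_ratio I (\<lambda>x. - f x) x = - deriv_on I (deriv_on I f) x / - deriv_on I f x"
    if "x \<in> I" for x
    using S_class_derivs(3)[OF f] that by (intro neg(3)) simp_all
  then show "deriv_ratio I (\<lambda>x. - f x) x = deriv_ratio I f x" if "x \<in> I" for x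
    using that by (simp add: deriv_ratio_def)
qed

lemma at_within_interval_between:
  fixes I :: "real set"
  assumes "is_interval I" "a \<in> I" "b \<in> I" "a < x" "x < b"
  shows "x \<in> I" "x \<in> interior I" "at x within I = at x"
proof -
  have sub: "{a<..<b} \<subseteq> I"
    using mem_is_interval_1_I[OF assms(1-3)] by (simp add: subset_iff)
  have "x \<in> {a<..<b}" using assms(4,5) by simp
  then show "x \<in> I" and int: "x \<in> interior I"
    using sub interior_maximal[OF sub open_greaterThanLessThan] by (simp_all add: subset_iff)
  show "at x within I = at x" by (rule at_within_interior[OF int])
qed

lemma S_class_deriv_sign:
  assumes "is_interval I" "f \<in> S_class I"
  shows "(\<forall>x\<in>I. deriv_on I f x > 0) \<or> (\<forall>x\<in>I. deriv_on I f x < 0)"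
proof (rule ccontr)
  assume "\<not> ?thesis"
  then obtain x y where xy: "x \<in> I" "y \<in> I" "deriv_on I f x \<le> 0" "0 \<le> deriv_on I f y"
    by (auto simp: not_less)
  have "connected (deriv_on I f ` I)"
    using connected_continuous_image[OF S_class_continuous(2)[OF assms(2)]] assms(1)
    by (simp add: is_interval_connected_1)
  then have "0 \<in> deriv_on I f ` I"
    using connectedD_interval[OF _ imageI[OF xy(1)] imageI[OF xy(2)] xy(3,4)] by simp
  then show False using S_class_derivs(3)[OF assms(2)] by auto
qed

lemma S_class_strict_mono:
  assumes I: "is_interval I" and f: "f \<in> S_class I" and pos: "\<forall>x\<in>I. deriv_on I f x > 0"
  shows "strict_mono_on I f"
proof (rule monotone_onI)
  fix a b assume ab: "a \<in> I" "b \<in> I" "a < b"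
  have "{a..b} \<subseteq> I" using mem_is_interval_1_I[OF I ab(1,2)] by (simp add: subset_iff)
  then have "continuous_on {a..b} f"
    by (rule continuous_on_subset[OF S_class_continuous(1)[OF f]])
  moreover have "\<exists>y. DERIV f x :> y \<and> y > 0" if "a < x" "x < b" for x
    using S_class_derivs(1)[OF f, of x] at_within_interval_between[OF I ab(1,2) that] pos by auto
  ultimately show "f a < f b" using DERIV_pos_imp_increasing_open[OF ab(3)] by blast
qed

text \<open>
  A derivative without zeros on an interval has constant sign, and \<open>f\<close> and \<open>- f\<close> have the same
  mean and the same ratio.
\<close>

lemma S_class_increasing_representative:
  assumes I: "is_interval I" "interior I \<noteq> {}" and f: "f \<in> S_class I"
  obtains f' where "f' \<in> S_class I" "\<forall>x\<in>I. deriv_on I f' x > 0" "strict_mono_on I f'"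
    "\<And>v. qa_mean I f' v = qa_mean I f v" "\<And>x. x \<in> I \<Longrightarrow> deriv_ratio I f' x = deriv_ratio I f x"
proof (cases "\<forall>x\<in>I. deriv_on I f x > 0")
  case True
  then show ?thesis using that[of f] f S_class_strict_mono[OF I(1) f] by simp
next
  case False
  then have "\<forall>x\<in>I. deriv_on I (\<lambda>x. - f x) x > 0"
    using S_class_deriv_sign[OF I(1) f] S_class_neg(2)[OF I f] by auto
  then show ?thesis
    using that[of "\<lambda>x. - f x"] S_class_neg(1,3)[OF I f]
      S_class_strict_mono[OF I(1) S_class_neg(1)[OF I f]] qa_mean_neg[of I f] by simp
qed

lemma S_class_subset_CM:
  assumes I: "is_interval I" "interior I \<noteq> {}" and f: "f \<in> S_class I"
  shows "f \<in> CM I"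
proof -
  have "strict_mono_on I f \<or> strict_mono_on I (\<lambda>x. - f x)"
    using S_class_deriv_sign[OF I(1) f] S_class_strict_mono[OF I(1) f]
      S_class_strict_mono[OF I(1) S_class_neg(1)[OF I f]] by (auto simp: S_class_neg(2)[OF I f])
  then show ?thesis
    using S_class_continuous(1)[OF f] by (auto simp: CM_def monotone_on_def)
qed

section \<open>Comparison through the ratio of derivatives\<close>

text \<open>
  Such pairs \<open>[x, y]\<close> are the tuples with \<open>A\<^sup>f [x, y] = x0\<close>; they are the ones at which relative
  convexity is tested near \<open>x0\<close>.
\<close>

lemma symmetric_points:
  fixes f :: "real \<Rightarrow> real"
  assumes "continuous_on {c..d} f" "strict_mono_on {c..d} f" "c < x0" "x0 < d"
  obtains x y where "c \<le> x" "x < x0" "x0 < y" "y \<le> d" "f x + f y = 2 * f x0"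
proof -
  define h where "h = min (f d - f x0) (f x0 - f c)"
  have "f c < f x0" "f x0 < f d" using assms by (auto intro: strict_mono_onD)
  then have h: "h > 0" "f x0 + h \<le> f d" "f c \<le> f x0 - h" by (auto simp: h_def)
  have sub: "continuous_on {c..x0} f" "continuous_on {x0..d} f"
    using assms by (auto intro: continuous_on_subset)
  obtain y where y: "x0 \<le> y" "y \<le> d" "f y = f x0 + h"
    using IVT'[of f x0 "f x0 + h" d] h sub assms by auto
  obtain x where x: "c \<le> x" "x \<le> x0" "f x = f x0 - h"
    using IVT'[of f c "f x0 - h" x0] h sub assms by auto
  have "x \<noteq> x0" "y \<noteq> x0" using x y h by auto
  then show ?thesis using that[of x y] x y by auto
qed

text \<open>
  Let \<open>q\<close> denote the touching function. Subtracting from \<open>q - s x0\<close> the multiple of \<open>f - f x0\<close> with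
  the same slope at \<open>x0\<close> leaves a function \<open>r\<close> with a critical point there. If the inequality
  failed, \<open>r\<close> would have a strict local maximum at \<open>x0\<close>. At two points whose \<open>f\<close>-values are
  symmetric about \<open>f x0\<close> the subtracted terms cancel, so the values of \<open>q\<close>, and hence those of
  \<open>s\<close>, would average to less than \<open>s x0\<close>. Working with such points avoids differentiating the
  inverse of \<open>f\<close>.
\<close>

lemma second_order_condition_at_touching_point:
  assumes I: "is_interval I" "interior I \<noteq> {}" and f: "f \<in> S_class I" and g: "g \<in> S_class I"
    and conv: "qa_convex I f s"
    and x: "x1 \<in> I" "x2 \<in> I" "x1 < x0" "x0 < x2"
    and touch: "\<And>x. x1 \<le> x \<Longrightarrow> x \<le> x2 \<Longrightarrow>
      s x \<le> s x0 + p * (g x - g x0) - e * (g x - g x0)\<^sup>2"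
  shows "2 * e * (deriv_on I g x0)\<^sup>2
    \<le> p * deriv_on I g x0 * (deriv_ratio I g x0 - deriv_ratio I f x0)"
proof -
  obtain f' where f': "f' \<in> S_class I" "strict_mono_on I f'"
    "\<And>v. qa_mean I f' v = qa_mean I f v" "\<And>x. x \<in> I \<Longrightarrow> deriv_ratio I f' x = deriv_ratio I f x"
    using S_class_increasing_representative[OF I f] by metis
  have conv': "qa_convex I f' s" using conv by (simp add: qa_convex_def f'(3))
  have x0: "x0 \<in> I" using at_within_interval_between[OF I(1) x] by simp
  \<comment> \<open>The factor \<open>k\<close> makes the slope of \<open>r\<close> vanish at \<open>x0\<close>; \<open>r1\<close> is the derivative of \<open>r\<close>, and \<open>m\<close> that of \<open>r1\<close> at \<open>x0\<close>.\<close>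
  define k where "k = p * deriv_on I g x0 / deriv_on I f' x0"
  define r where "r = (\<lambda>x. p * (g x - g x0) - e * (g x - g x0)\<^sup>2 - k * (f' x - f' x0))"
  define r1 where
    "r1 = (\<lambda>x. (p - 2 * e * (g x - g x0)) * deriv_on I g x - k * deriv_on I f' x)"
  define m where "m = p * deriv_on I (deriv_on I g) x0 - 2 * e * (deriv_on I g x0)\<^sup>2
    - k * deriv_on I (deriv_on I f') x0"
  have k: "k * deriv_on I f' x0 = p * deriv_on I g x0"
    using S_class_derivs(3)[OF f'(1) x0] by (simp add: k_def)
  have m: "m = p * deriv_on I g x0 * (deriv_ratio I g x0 - deriv_ratio I f x0)
      - 2 * e * (deriv_on I g x0)\<^sup>2"
    using S_class_derivs(3)[OF g x0] S_class_derivs(3)[OF f'(1) x0]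
    unfolding f'(4)[OF x0, symmetric] by (simp add: m_def k_def deriv_ratio_def algebra_simps)
  have dr: "(r has_real_derivative r1 x) (at x)" if "x1 < x" "x < x2" for x
  proof -
    note at = at_within_interval_between[OF I(1) x(1,2) that]
    have "(g has_real_derivative deriv_on I g x) (at x)"
      "(f' has_real_derivative deriv_on I f' x) (at x)"
      using S_class_derivs(1)[OF g at(1)] S_class_derivs(1)[OF f'(1) at(1)] at(3) by simp_all
    then show ?thesis unfolding r_def r1_def
      by (auto intro!: derivative_eq_intros simp: algebra_simps)
  qed
  have dr1: "(r1 has_real_derivative m) (at x0)"
  proof -
    note at = at_within_interval_between(1,3)[OF I(1) x]
    have "(g has_real_derivative deriv_on I g x0) (at x0)"
      "(deriv_on I g has_real_derivative deriv_on I (deriv_on I g) x0) (at x0)"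
      "(deriv_on I f' has_real_derivative deriv_on I (deriv_on I f') x0) (at x0)"
      using S_class_derivs(1,2)[OF g at(1)] S_class_derivs(2)[OF f'(1) at(1)] at(2) by simp_all
    then show ?thesis unfolding r1_def m_def
      by (auto intro!: derivative_eq_intros simp: algebra_simps power2_eq_square)
  qed
  show ?thesis
  proof (rule ccontr)
    assume "\<not> ?thesis"
    then have "m < 0" by (simp add: m)
    moreover have "r1 x0 = 0" using k by (simp add: r1_def)
    ultimately obtain c d where cd: "x1 < c" "c < x0" "x0 < d" "d < x2"
      and neg: "\<And>x. c \<le> x \<Longrightarrow> x \<le> d \<Longrightarrow> x \<noteq> x0 \<Longrightarrow> r x < r x0"
      using strict_local_max_second_derivative[of x1 x2 r r1 m x0] dr dr1 x(3,4) by blast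
    have sub: "{c..d} \<subseteq> I"
      using mem_is_interval_1_I[OF I(1) x(1,2)] cd by (simp add: subset_iff)
    have "continuous_on {c..d} f'" "strict_mono_on {c..d} f'"
      using continuous_on_subset[OF S_class_continuous(1)[OF f'(1)] sub]
        monotone_on_subset[OF f'(2) sub] .
    then obtain a b where ab: "c \<le> a" "a < x0" "x0 < b" "b \<le> d" "f' a + f' b = 2 * f' x0"
      using symmetric_points cd by metis
    have tup: "[a, b] \<in> tuples I" using ab cd sub by (auto simp: tuples_def)
    have inj: "inj_on f' I" using f'(2) strict_mono_on_imp_inj_on by blast
    have "qa_mean I f' [a, b] = x0"
      using ab(5) inv_into_f_f[OF inj x0] by (simp add: qa_mean_def)
    then have "2 * s x0 \<le> s a + s b"
      using conv' tup by (auto simp: qa_convex_def)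
    also have "s a + s b \<le> (s x0 + p * (g a - g x0) - e * (g a - g x0)\<^sup>2)
        + (s x0 + p * (g b - g x0) - e * (g b - g x0)\<^sup>2)"
      using ab cd by (intro add_mono touch) auto
    also have "\<dots> = 2 * s x0 + (r a + r b) + k * (f' a + f' b - 2 * f' x0)"
      by (simp add: r_def algebra_simps)
    also have "\<dots> = 2 * s x0 + (r a + r b)" using ab(5) by simp
    finally have "0 \<le> r a + r b" by simp
    moreover have "r a < 0" "r b < 0"
      using neg[of a] neg[of b] ab cd by (auto simp: r_def)
    ultimately show False by simp
  qed
qed

lemma qa_convex_if_convex_on:
  assumes I: "is_interval I" and g: "continuous_on I g" and inj: "inj_on g I"
    and conv: "convex_on (g ` I) (\<lambda>t. s (inv_into I g t))"
  shows "qa_convex I g s"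
  unfolding qa_convex_def
proof
  fix v assume v: "v \<in> tuples I"
  then have v': "v \<noteq> []" and vI: "\<And>i. i < length v \<Longrightarrow> v ! i \<in> I" by (auto simp: tuples_def)
  let ?\<phi> = "\<lambda>t. s (inv_into I g t)"
  have "s (qa_mean I g v) = ?\<phi> (\<Sum>i<length v. (1 / real (length v)) *\<^sub>R g (v ! i))"
    by (simp add: qa_mean_def average_as_sum(1)[OF v'])
  also have "\<dots> \<le> (\<Sum>i<length v. (1 / real (length v)) * ?\<phi> (g (v ! i)))"
    using v' vI average_as_sum(2)[OF v'] by (intro convex_on_sum[OF _ _ conv]) auto
  also have "\<dots> = (\<Sum>i<length v. (1 / real (length v)) * s (v ! i))"
    using vI inj by (intro sum.cong) auto
  also have "\<dots> = sum_list (map s v) / real (length v)"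
    by (simp add: average_as_sum(1)[OF v'])
  finally show "s (qa_mean I g v) \<le> sum_list (map s v) / real (length v)" .
qed

text \<open>
  The sign \<open>\<sigma>\<close> tells whether \<open>s\<close> is increasing or decreasing. Monotonicity of \<open>s\<close> forces the
  slope \<open>p\<close> of a touching parabola to have the sign \<open>\<sigma>\<close>, so the factor \<open>p\<close> turns the assumed
  one-sided approximation of the ratio of \<open>g\<close> into an upper bound for the right-hand side of the
  second-order condition.
\<close>

lemma qa_convex_transfer_increasing:
  assumes I: "is_interval I" "interior I \<noteq> {}" and g: "g \<in> S_class I"
    and pos: "\<forall>x\<in>I. deriv_on I g x > 0"
    and s: "continuous_on I s" and \<sigma>: "\<sigma> = 1 \<or> \<sigma> = - 1" and mono: "mono_on I (\<lambda>x. \<sigma> * s x)"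
    and approx: "\<And>x e. x \<in> I \<Longrightarrow> e > 0 \<Longrightarrow> \<exists>f\<in>S_class I. qa_convex I f s \<and>
      \<sigma> * (deriv_ratio I g x - deriv_ratio I f x) < e"
  shows "qa_convex I g s"
proof -
  have gm: "strict_mono_on I g" using S_class_strict_mono[OF I(1) g pos] .
  then have inj: "inj_on g I" by (rule strict_mono_on_imp_inj_on)
  note gc = S_class_continuous(1)[OF g]
  have "path_connected I" using I(1) is_interval_path_connected by blast
  then obtain h where h: "homeomorphism I (g ` I) g h"
    using injective_into_1d_eq_homeomorphism[OF gc] inj by blast
  have hinv: "inv_into I g t = h t" if "t \<in> g ` I" for t
    using that homeomorphism_apply1[OF h] inv_into_f_f[OF inj] by (elim imageE) simp
  have "continuous_on (g ` I) (\<lambda>t. s (h t))"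
    using continuous_on_compose2[OF s homeomorphism_cont2[OF h]] homeomorphism_image2[OF h] by simp
  then have cont: "continuous_on (g ` I) (\<lambda>t. s (inv_into I g t))"
    by (simp add: hinv cong: continuous_on_cong)
  have convJ: "convex (g ` I)"
    using connected_continuous_image[OF gc] I(1)
    by (simp add: is_interval_connected_1 flip: is_interval_convex_1)
  have "convex_on (g ` I) (\<lambda>t. s (inv_into I g t))"
  proof (rule convex_on_if_not_touched_by_concave_parabola[OF convJ cont])
    fix a b t p e :: real
    assume ab: "a \<in> g ` I" "b \<in> g ` I" and t: "a < t" "t < b" and e: "e > 0"
    have "t \<in> g ` I"
      using mem_is_interval_1_I[OF _ ab] t convJ by (simp add: is_interval_convex_1)
    then obtain x1 x2 x0 where x: "x1 \<in> I" "x2 \<in> I" "x0 \<in> I"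
      and gx: "a = g x1" "b = g x2" "t = g x0" using ab by auto
    have lt: "x1 < x0" "x0 < x2" using t x strict_mono_on_less[OF gm] by (auto simp: gx)
    show "\<exists>u\<in>{a..b}. s (inv_into I g u)
        > s (inv_into I g t) + p * (u - t) - e * (u - t)\<^sup>2"
    proof (rule ccontr)
      assume contra: "\<not> ?thesis"
      have touch: "s x \<le> s x0 + p * (g x - g x0) - e * (g x - g x0)\<^sup>2"
        if "x1 \<le> x" "x \<le> x2" for x
      proof -
        have "x \<in> I" using mem_is_interval_1_I[OF I(1) x(1,2) that] .
        moreover have "g x \<in> {a..b}"
          using that x \<open>x \<in> I\<close> by (simp add: gx strict_mono_on_less_eq[OF gm])
        ultimately show ?thesis
          using contra inv_into_f_f[OF inj \<open>x \<in> I\<close>] inv_into_f_f[OF inj x(3)]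
          by (metis gx(3) not_less)
      qed
      define D where "D = deriv_on I g x0"
      have D: "D > 0" using pos x by (simp add: D_def)
      \<comment> \<open>With this tolerance the second-order condition gives \<open>2 e D\<^sup>2 < 2 e D\<^sup>2\<close>; the summand \<open>1\<close> covers \<open>p = 0\<close>.\<close>
      define \<delta> where "\<delta> = 2 * e * D / (\<bar>p\<bar> + 1)"
      have \<delta>: "\<delta> > 0" using e D by (simp add: \<delta>_def add_nonneg_pos)
      obtain f where f: "f \<in> S_class I" "qa_convex I f s"
        "\<sigma> * (deriv_ratio I g x0 - deriv_ratio I f x0) < \<delta>"
        using approx[OF x(3) \<delta>] by blast
      have p: "p = \<sigma> * \<bar>p\<bar>"
      proof -
        have "\<sigma> * p \<ge> 0"
        proof (cases "\<sigma> = 1")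
          case True
          \<comment> \<open>Compare \<open>s\<close> with the parabola on the side of \<open>x0\<close> where \<open>s\<close> is at least \<open>s x0\<close>.\<close>
          have "s x0 \<le> s x2" using monotone_onD[OF mono x(3,2)] lt True by simp
          also have "s x2 \<le> s x0 + p * (g x2 - g x0) - e * (g x2 - g x0)\<^sup>2"
            using touch lt by simp
          finally have "0 \<le> p * (g x2 - g x0)" using e
            by (smt (verit) mult_nonneg_nonneg zero_le_power2)
          then show ?thesis using t True by (simp add: gx zero_le_mult_iff)
        next
          case False
          then have \<sigma>': "\<sigma> = - 1" using \<sigma> by simp
          have "s x0 \<le> s x1" using monotone_onD[OF mono x(1,3)] lt \<sigma>' by simp
          also have "s x1 \<le> s x0 + p * (g x1 - g x0) - e * (g x1 - g x0)\<^sup>2"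
            using touch lt by simp
          finally have "0 \<le> p * (g x1 - g x0)" using e
            by (smt (verit) mult_nonneg_nonneg zero_le_power2)
          then show ?thesis using t \<sigma>' by (simp add: gx zero_le_mult_iff)
        qed
        then show ?thesis using \<sigma> by auto
      qed
      have "2 * e * D\<^sup>2 \<le> p * D * (deriv_ratio I g x0 - deriv_ratio I f x0)"
        unfolding D_def
        by (rule second_order_condition_at_touching_point[OF I f(1) g f(2) x(1,2) lt touch])
      also have "\<dots> = \<bar>p\<bar> * D * (\<sigma> * (deriv_ratio I g x0 - deriv_ratio I f x0))"
        using p by (metis mult.commute mult.left_commute)
      also have "\<dots> \<le> \<bar>p\<bar> * D * \<delta>"
        using f(3) D by (intro mult_left_mono) auto
      also have "\<dots> < (\<bar>p\<bar> + 1) * D * \<delta>"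
        using D \<delta> by simp
      also have "\<dots> = 2 * e * D\<^sup>2"
        by (simp add: \<delta>_def power2_eq_square add_nonneg_pos)
      finally show False by simp
    qed
  qed
  then show ?thesis by (rule qa_convex_if_convex_on[OF I(1) gc inj])
qed

lemma qa_convex_transfer:
  assumes I: "is_interval I" "interior I \<noteq> {}" and g: "g \<in> S_class I"
    and s: "continuous_on I s" and \<sigma>: "\<sigma> = 1 \<or> \<sigma> = - 1" and mono: "mono_on I (\<lambda>x. \<sigma> * s x)"
    and approx: "\<And>x e. x \<in> I \<Longrightarrow> e > 0 \<Longrightarrow> \<exists>f\<in>S_class I. qa_convex I f s \<and>
      \<sigma> * (deriv_ratio I g x - deriv_ratio I f x) < e"
  shows "qa_convex I g s"
proof -
  obtain g' where g': "g' \<in> S_class I" "\<forall>x\<in>I. deriv_on I g' x > 0"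
    "\<And>v. qa_mean I g' v = qa_mean I g v" "\<And>x. x \<in> I \<Longrightarrow> deriv_ratio I g' x = deriv_ratio I g x"
    using S_class_increasing_representative[OF I g] by metis
  have "qa_convex I g' s"
    using approx g'(4) by (intro qa_convex_transfer_increasing[OF I g'(1,2) s \<sigma> mono]) auto
  then show ?thesis by (simp add: qa_convex_def g'(3))
qed

lemma CM_increasing_representative:
  assumes "s \<in> CM I"
  obtains s' where "continuous_on I s'" "strict_mono_on I s'"
    "\<And>v. qa_mean I s' v = qa_mean I s v"
proof (cases "strict_mono_on I s")
  case True
  then show ?thesis using assms that[of s] by (simp add: CM_def)
next
  case False
  then show ?thesis
    using assms that[of "\<lambda>x. - s x"] qa_mean_neg
    by (auto simp: CM_def monotone_on_def intro: continuous_intros)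
qed

text \<open>
  Choosing an increasing representative of \<open>s\<close> turns both hypothesis and conclusion into relative
  convexity, so that the transfer applies with \<open>\<sigma> = 1\<close>; the lemma after it is the dual statement, obtained from a
  decreasing representative.
\<close>

lemma qa_le_supremum:
  assumes I: "is_interval I" "interior I \<noteq> {}" and g: "g \<in> S_class I" and s: "s \<in> CM I"
    and F: "F \<subseteq> S_class I" "\<And>f. f \<in> F \<Longrightarrow> qa_le I f s"
    and approx: "\<And>x e. x \<in> I \<Longrightarrow> e > 0 \<Longrightarrow> \<exists>f\<in>F. deriv_ratio I g x - deriv_ratio I f x < e"
  shows "qa_le I g s"
proof -
  obtain s' where s': "continuous_on I s'" "strict_mono_on I s'"
    "\<And>v. qa_mean I s' v = qa_mean I s v"
    using CM_increasing_representative[OF s] by metis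
  have conv: "qa_convex I f s'" if "f \<in> F" for f
  proof -
    have "qa_le I f s'" using F(2)[OF that] by (simp add: qa_le_def s'(3))
    then show ?thesis
      using qa_le_iff_qa_convex[OF I(1) S_class_continuous(1) s'(1,2)] F(1) that by blast
  qed
  have "mono_on I (\<lambda>x. 1 * s' x)" using s'(2) by (simp add: strict_mono_on_imp_mono_on)
  then have "qa_convex I g s'"
    using approx conv F(1)
    by (intro qa_convex_transfer[OF I g s'(1), of 1]) (simp_all, blast)
  then have "qa_le I g s'"
    using qa_le_iff_qa_convex[OF I(1) S_class_continuous(1)[OF g] s'(1,2)] by blast
  then show ?thesis by (simp add: qa_le_def s'(3))
qed

lemma infimum_qa_le:
  assumes I: "is_interval I" "interior I \<noteq> {}" and h: "h \<in> S_class I" and s: "s \<in> CM I"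
    and F: "F \<subseteq> S_class I" "\<And>f. f \<in> F \<Longrightarrow> qa_le I s f"
    and approx: "\<And>x e. x \<in> I \<Longrightarrow> e > 0 \<Longrightarrow> \<exists>f\<in>F. deriv_ratio I f x - deriv_ratio I h x < e"
  shows "qa_le I s h"
proof -
  obtain t where t: "continuous_on I t" "strict_mono_on I t"
    "\<And>v. qa_mean I t v = qa_mean I s v"
    using CM_increasing_representative[OF s] by metis
  define s' where "s' = (\<lambda>x. - t x)"
  have s': "continuous_on I s'" "strict_antimono_on I s'" "\<And>v. qa_mean I s' v = qa_mean I s v"
    using t by (auto simp: s'_def monotone_on_def qa_mean_neg intro: continuous_intros)
  have conv: "qa_convex I f s'" if "f \<in> F" for f
  proof -
    have "qa_le I s' f" using F(2)[OF that] by (simp add: qa_le_def s'(3))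
    then show ?thesis
      using qa_ge_iff_qa_convex[OF I(1) S_class_continuous(1) s'(1,2)] F(1) that by blast
  qed
  have "mono_on I (\<lambda>x. - 1 * s' x)" using t(2) by (simp add: s'_def strict_mono_on_imp_mono_on)
  then have "qa_convex I h s'"
    using approx conv F(1)
    by (intro qa_convex_transfer[OF I h s'(1), of "- 1"]) (simp_all, blast)
  then have "qa_le I s' h"
    using qa_ge_iff_qa_convex[OF I(1) S_class_continuous(1)[OF h] s'(1,2)] by blast
  then show ?thesis by (simp add: qa_le_def s'(3))
qed

text \<open>
  Since \<open>g \<prec> g\<close>, the transfer for the family consisting of \<open>g\<close> alone, with \<open>g\<close> also in the role
  of \<open>s\<close>, gives the classical comparison of generators.
\<close>

lemma qa_le_if_deriv_ratio_le:
  assumes I: "is_interval I" "interior I \<noteq> {}" and fg: "f \<in> S_class I" "g \<in> S_class I"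
    and le: "\<And>x. x \<in> I \<Longrightarrow> deriv_ratio I f x \<le> deriv_ratio I g x"
  shows "qa_le I f g"
proof (rule qa_le_supremum[OF I fg(1) S_class_subset_CM[OF I fg(2)], of "{g}"])
  show "\<exists>f'\<in>{g}. deriv_ratio I f x - deriv_ratio I f' x < e" if "x \<in> I" "e > 0" for x e
    using le[OF that(1)] that(2) by simp
qed (use fg in \<open>auto simp: qa_le_def\<close>)

section \<open>Generators with a prescribed ratio\<close>

text \<open>
  The interval may be open, half-open or unbounded, so the fundamental theorem of calculus is applied
  on a compact subinterval that contains \<open>a\<close> and is a neighbourhood of \<open>x\<close> relative to \<open>I\<close>.
\<close>

lemma antiderivative_on_interval:
  fixes G :: "real \<Rightarrow> real"
  assumes I: "is_interval I" and G: "continuous_on I G" and a: "a \<in> I"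
  obtains P where "\<And>x. x \<in> I \<Longrightarrow> (P has_real_derivative G x) (at x within I)"
proof
  fix x assume x: "x \<in> I"
  have "\<exists>c\<in>I. c \<le> a \<and> c \<le> x \<and> (c = x \<longrightarrow> (\<forall>y\<in>I. x \<le> y))"
  proof (cases "\<forall>y\<in>I. x \<le> y")
    case True
    then show ?thesis using a x by auto
  next
    case False
    then obtain y where "y \<in> I" "y < x" by (auto simp: not_le)
    then show ?thesis using a by (intro bexI[of _ "min a y"]) (auto simp: min_def)
  qed
  then obtain c where c: "c \<in> I" "c \<le> a" "c \<le> x" "c = x \<Longrightarrow> (\<forall>y\<in>I. x \<le> y)" by blast
  have "\<exists>d\<in>I. a \<le> d \<and> x \<le> d \<and> (d = x \<longrightarrow> (\<forall>y\<in>I. y \<le> x))"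
  proof (cases "\<forall>y\<in>I. y \<le> x")
    case True
    then show ?thesis using a x by auto
  next
    case False
    then obtain y where "y \<in> I" "x < y" by (auto simp: not_le)
    then show ?thesis using a by (intro bexI[of _ "max a y"]) (auto simp: max_def)
  qed
  then obtain d where d: "d \<in> I" "a \<le> d" "x \<le> d" "d = x \<Longrightarrow> (\<forall>y\<in>I. y \<le> x)" by blast
  have sub: "{c..d} \<subseteq> I" using mem_is_interval_1_I[OF I c(1) d(1)] by (simp add: subset_iff)
  \<comment> \<open>An open set in which \<open>{c..d}\<close> and \<open>I\<close> agree; an end that coincides with \<open>x\<close> is an end of \<open>I\<close>.\<close>
  define S where "S = (if c < x then {c<..} else UNIV) \<inter> (if x < d then {..<d} else UNIV)"
  have "open S" "x \<in> S" by (auto simp: S_def)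
  moreover have "{c..d} \<inter> S - {x} = I \<inter> S - {x}"
  proof -
    have "c \<le> y \<and> y \<le> d" if "y \<in> I" "y \<in> S" for y
      using that c(3,4) d(3,4) by (cases "c = x"; cases "d = x") (auto simp: S_def)
    then show ?thesis using sub by auto
  qed
  ultimately have "at x within {c..d} = at x within I"
    by (intro at_within_nhd) auto
  moreover have "((\<lambda>u. LBINT y=a..u. G y) has_vector_derivative G x) (at x within {c..d})"
    using c d continuous_on_subset[OF G sub] by (intro interval_integral_FTC2) auto
  ultimately show "((\<lambda>u. LBINT y=a..u. G y) has_real_derivative G x) (at x within I)"
    by (simp add: has_real_derivative_iff_has_vector_derivative)
qed

text \<open>
  If \<open>P' = G\<close> and \<open>g' = exp P\<close>, then \<open>g'\<close> is positive and \<open>g''/g' = P' = G\<close>.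
\<close>

lemma S_class_with_deriv_ratio:
  assumes I: "is_interval I" "interior I \<noteq> {}" and G: "continuous_on I G"
  obtains g where "g \<in> S_class I" "\<And>x. x \<in> I \<Longrightarrow> deriv_ratio I g x = G x"
proof -
  obtain a where a: "a \<in> I" using I(2) interior_subset by blast
  obtain P where P: "\<And>x. x \<in> I \<Longrightarrow> (P has_real_derivative G x) (at x within I)"
    using antiderivative_on_interval[OF I(1) G a] by blast
  have E: "((\<lambda>x. exp (P x)) has_real_derivative exp (P x) * G x) (at x within I)"
    if "x \<in> I" for x
    using P[OF that] by (auto intro!: derivative_eq_intros)
  then have cont: "continuous_on I (\<lambda>x. exp (P x))" by (rule DERIV_continuous_on)
  then obtain g where g: "\<And>x. x \<in> I \<Longrightarrow> (g has_real_derivative exp (P x)) (at x within I)"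
    using antiderivative_on_interval[OF I(1) _ a] by blast
  have "continuous_on I (\<lambda>x. exp (P x) * G x)" using cont G by (rule continuous_on_mult)
  note g' = S_classI[OF I g E this]
  show ?thesis
    using that[of g] g'(1,3) by simp
qed

section \<open>The envelopes of a family\<close>

text \<open>
  The generator \<open>g\<close> lies in \<open>\<Inter>f. U\<^sub>f\<close> because its ratio dominates all others, and its mean is below
  every mean generated there because its ratio is the pointwise supremum; so the infimum is attained
  at \<open>g\<close>.
\<close>

lemma upper_mean_eq:
  assumes I: "is_interval I" "interior I \<noteq> {}" and F: "F \<subseteq> S_class I" and g: "g \<in> S_class I"
    and G: "\<And>x. x \<in> I \<Longrightarrow> ereal (deriv_ratio I g x) = (SUP f\<in>F. ereal (deriv_ratio I f x))"
    and v: "v \<in> tuples I"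
  shows "upper_mean I F v = qa_mean I g v"
proof -
  let ?U = "CM I \<inter> (\<Inter>f\<in>F. upper_set I f)"
  have "deriv_ratio I f x \<le> deriv_ratio I g x" if "f \<in> F" "x \<in> I" for f x
    using SUP_upper[OF that(1), of "\<lambda>f. ereal (deriv_ratio I f x)"] by (simp flip: G[OF that(2)])
  then have "qa_le I f g" if "f \<in> F" for f
    using that F g by (intro qa_le_if_deriv_ratio_le[OF I]) auto
  then have gU: "g \<in> ?U"
    using S_class_subset_CM[OF I g] by (auto simp: upper_set_def)
  have approx: "\<exists>f\<in>F. deriv_ratio I g x - deriv_ratio I f x < e" if "x \<in> I" "e > 0" for x e
  proof -
    have "ereal (deriv_ratio I g x - e) < (SUP f\<in>F. ereal (deriv_ratio I f x))"
      using that by (simp flip: G[OF that(1)])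
    then obtain f where "f \<in> F" "deriv_ratio I g x - e < deriv_ratio I f x"
      by (auto simp: less_SUP_iff)
    then show ?thesis by (intro bexI[of _ f]) auto
  qed
  have "qa_mean I g v \<le> qa_mean I s v" if "s \<in> ?U" for s
    using qa_le_supremum[OF I g _ F _ approx, of s] that v by (auto simp: upper_set_def qa_le_def)
  then have "(INF s\<in>?U. qa_mean I s v) = qa_mean I g v"
    using gU by (intro cInf_eq_minimum) auto
  then show ?thesis using gU by (auto simp: upper_mean_def)
qed

lemma lower_mean_eq:
  assumes I: "is_interval I" "interior I \<noteq> {}" and F: "F \<subseteq> S_class I" and h: "h \<in> S_class I"
    and H: "\<And>x. x \<in> I \<Longrightarrow> ereal (deriv_ratio I h x) = (INF f\<in>F. ereal (deriv_ratio I f x))"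
    and v: "v \<in> tuples I"
  shows "lower_mean I F v = qa_mean I h v"
proof -
  let ?L = "CM I \<inter> (\<Inter>f\<in>F. lower_set I f)"
  have "deriv_ratio I h x \<le> deriv_ratio I f x" if "f \<in> F" "x \<in> I" for f x
    using INF_lower[OF that(1), of "\<lambda>f. ereal (deriv_ratio I f x)"] by (simp flip: H[OF that(2)])
  then have "qa_le I h f" if "f \<in> F" for f
    using that F h by (intro qa_le_if_deriv_ratio_le[OF I]) auto
  then have hL: "h \<in> ?L"
    using S_class_subset_CM[OF I h] by (auto simp: lower_set_def)
  have approx: "\<exists>f\<in>F. deriv_ratio I f x - deriv_ratio I h x < e" if "x \<in> I" "e > 0" for x e
  proof -
    have "(INF f\<in>F. ereal (deriv_ratio I f x)) < ereal (deriv_ratio I h x + e)"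
      using that by (simp flip: H[OF that(1)])
    then obtain f where "f \<in> F" "deriv_ratio I f x < deriv_ratio I h x + e"
      by (auto simp: INF_less_iff)
    then show ?thesis by (intro bexI[of _ f]) auto
  qed
  have "qa_mean I s v \<le> qa_mean I h v" if "s \<in> ?L" for s
    using infimum_qa_le[OF I h _ F _ approx, of s] that v by (auto simp: lower_set_def qa_le_def)
  then have "(SUP s\<in>?L. qa_mean I s v) = qa_mean I h v"
    using hL by (intro cSup_eq_maximum) auto
  then show ?thesis using hL by (auto simp: lower_mean_def)
qed

theorem theorem1:
  fixes I :: "real set" and F :: "(real \<Rightarrow> real) set"
  assumes "is_interval I" and "interior I \<noteq> {}" and "F \<subseteq> S_class I"
  shows "(\<forall>G :: real \<Rightarrow> real.
            (\<forall>x\<in>I. ereal (G x) = (SUP f\<in>F. ereal (deriv_ratio I f x))) \<longrightarrow> continuous_on I G \<longrightarrow>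
              (\<exists>g\<in>S_class I. \<forall>x\<in>I. deriv_ratio I g x = G x) \<and>
              (\<forall>g\<in>S_class I. (\<forall>x\<in>I. deriv_ratio I g x = G x) \<longrightarrow>
                 (\<forall>v\<in>tuples I. upper_mean I F v = qa_mean I g v)))
       \<and> (\<forall>H :: real \<Rightarrow> real.
            (\<forall>x\<in>I. ereal (H x) = (INF f\<in>F. ereal (deriv_ratio I f x))) \<longrightarrow> continuous_on I H \<longrightarrow>
              (\<exists>h\<in>S_class I. \<forall>x\<in>I. deriv_ratio I h x = H x) \<and>
              (\<forall>h\<in>S_class I. (\<forall>x\<in>I. deriv_ratio I h x = H x) \<longrightarrow>
                 (\<forall>v\<in>tuples I. lower_mean I F v = qa_mean I h v)))"
proof (rule conjI; intro allI impI)
  fix G :: "real \<Rightarrow> real"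
  assume G: "\<forall>x\<in>I. ereal (G x) = (SUP f\<in>F. ereal (deriv_ratio I f x))" "continuous_on I G"
  have "\<exists>g\<in>S_class I. \<forall>x\<in>I. deriv_ratio I g x = G x"
    by (rule S_class_with_deriv_ratio[OF assms(1,2) G(2)]) blast
  moreover have "upper_mean I F v = qa_mean I g v"
    if "g \<in> S_class I" "\<forall>x\<in>I. deriv_ratio I g x = G x" "v \<in> tuples I" for g v
    using that(2) G(1) by (intro upper_mean_eq[OF assms that(1) _ that(3)]) simp
  ultimately show "(\<exists>g\<in>S_class I. \<forall>x\<in>I. deriv_ratio I g x = G x) \<and>
      (\<forall>g\<in>S_class I. (\<forall>x\<in>I. deriv_ratio I g x = G x) \<longrightarrow>
         (\<forall>v\<in>tuples I. upper_mean I F v = qa_mean I g v))"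
    by simp
next
  fix H :: "real \<Rightarrow> real"
  assume H: "\<forall>x\<in>I. ereal (H x) = (INF f\<in>F. ereal (deriv_ratio I f x))" "continuous_on I H"
  have "\<exists>h\<in>S_class I. \<forall>x\<in>I. deriv_ratio I h x = H x"
    by (rule S_class_with_deriv_ratio[OF assms(1,2) H(2)]) blast
  moreover have "lower_mean I F v = qa_mean I h v"
    if "h \<in> S_class I" "\<forall>x\<in>I. deriv_ratio I h x = H x" "v \<in> tuples I" for h v
    using that(2) H(1) by (intro lower_mean_eq[OF assms that(1) _ that(3)]) simp
  ultimately show "(\<exists>h\<in>S_class I. \<forall>x\<in>I. deriv_ratio I h x = H x) \<and>
      (\<forall>h\<in>S_class I. (\<forall>x\<in>I. deriv_ratio I h x = H x) \<longrightarrow>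
         (\<forall>v\<in>tuples I. lower_mean I F v = qa_mean I h v))"
    by simp
qed

end
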